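(* For any smooth solution $(\rho,u_1,u_2,u_3)$, with $\rho>0$ and $u_1>0$, of the three-dimensional steady isentropic compressible Euler system $$ \begin{cases} \partial_1(\rho u_1)+\partial_2(\rho u_2)+\partial_3(\rho u_3)=0,\\ \partial_1(\rho u_1^2)+\partial_2(\rho u_1u_2)+\partial_3(\rho u_1u_3)+\partial_1 p=0,\\ \partial_1(\rho u_1u_2)+\partial_2(\rho u_2^2)+\partial_3(\rho u_2u_3)+\partial_2 p=0,\\ \partial_1(\rho u_1u_3)+\partial_2(\rho u_2u_3)+\partial_3(\rho u_3^2)+\partial_3 p=0, \end{cases} $$ the quantity $W=\partial_2\beta_3-\partial_3\beta_2+\beta_3\partial_1\beta_2-\beta_2\partial_1\beta_3$ satisfies $$ \mathbf{D}W-W\,\mathbf{D}s-G^{-1}W\,\mathbf{D}G-\frac{c^2(\rho)\,G}{2(B-h(\rho))^2}\Big[(\partial_2B\,\partial_3s-\partial_3B\,\partial_2s)+\beta_2(\partial_3B\,\partial_1s-\partial_1B\,\partial_3s)+\beta_3(\partial_1B\,\partial_2s-\partial_2B\,\partial_1s)\Big]=0, $$ that is, $$ \mathbf{D}\Big(\frac{W}{\rho G}\Big)+\frac{c^2(\rho)}{2\rho^2(B-h(\rho))^2}\,\big[(1,\beta_2,\beta_3)\cdot(\nabla\rho\times\nabla B)\big]=0 . $$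
   Context: Here $x=(x_1,x_2,x_3)$, $\partial_i=\partial_{x_i}$, $\mathbf{u}=(u_1,u_2,u_3)$ is the velocity, $\rho$ the density, and the pressure is $p=p(\rho)=\frac{1}{\gamma}\rho^\gamma$ with $\gamma\in(1,3)$ (ideal polytropic gas). The sound speed $c(\rho)$ is given by $c^2(\rho)=p'(\rho)$, and $h(\rho)$ is the enthalpy, satisfying $h'(\rho)=p'(\rho)/\rho=c^2(\rho)/\rho$. The Bernoulli function is $B=\frac12(u_1^2+u_2^2+u_3^2)+h(\rho)$. Define $$s=\ln\rho,\qquad \beta_2=\frac{u_2}{u_1},\qquad \beta_3=\frac{u_3}{u_1},\qquad G=1+\beta_2^2+\beta_3^2,\qquad \mathbf{D}=\partial_1+\beta_2\partial_2+\beta_3\partial_3 .$$ Standing assumption: the flow contains no vacuum ($\rho>0$) and no stagnation points, and $u_1>0$. *)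

theory Defs
  imports "HOL-Analysis.Analysis"
begin

definition partial_deriv :: "'n::finite \<Rightarrow> (real^'n \<Rightarrow> real) \<Rightarrow> real^'n \<Rightarrow> real" (\<open>\<partial>\<close>)
  where "\<partial> i f x = deriv (\<lambda>t. f (x + t *\<^sub>R axis i 1)) 0"

definition grad :: "(real^'n::finite \<Rightarrow> real) \<Rightarrow> real^'n \<Rightarrow> real^'n"
  where "grad f x = (\<chi> i. \<partial> i f x)"

(* Meant for open S. For k = Suc j, Frechet differentiability makes the partial
   derivatives genuine (deriv is total) and gives continuity of f. *)
primrec Ck_on :: "nat \<Rightarrow> (real^'n::finite \<Rightarrow> real) \<Rightarrow> (real^'n) set \<Rightarrow> bool"
  where
    "Ck_on 0 f S \<longleftrightarrow> continuous_on S f"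
  | "Ck_on (Suc k) f S \<longleftrightarrow> (\<forall>x\<in>S. f differentiable (at x)) \<and> (\<forall>i. Ck_on k (\<partial> i f) S)"

definition smooth_on :: "(real^'n::finite) set \<Rightarrow> (real^'n \<Rightarrow> real) \<Rightarrow> bool"
  where "smooth_on S f \<longleftrightarrow> (\<forall>k. Ck_on k f S)"

definition pressure :: "real \<Rightarrow> real \<Rightarrow> real"
  where "pressure \<gamma> r = r powr \<gamma> / \<gamma>"

definition sound_speed :: "real \<Rightarrow> real \<Rightarrow> real"
  where "sound_speed \<gamma> r = sqrt (deriv (pressure \<gamma>) r)"

(* The enthalpy is determined only up to an additive constant; any choice is allowed. *)
definition is_enthalpy :: "real \<Rightarrow> (real \<Rightarrow> real) \<Rightarrow> bool"
  where "is_enthalpy \<gamma> h \<longleftrightarrow>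
    (\<forall>r>0. (h has_real_derivative deriv (pressure \<gamma>) r / r) (at r))"

definition steady_euler ::
    "(real^3) set \<Rightarrow> real \<Rightarrow> (real^3 \<Rightarrow> real) \<Rightarrow> (real^3 \<Rightarrow> real) \<Rightarrow> (real^3 \<Rightarrow> real)
      \<Rightarrow> (real^3 \<Rightarrow> real) \<Rightarrow> bool"
  where "steady_euler \<Omega> \<gamma> \<rho> u1 u2 u3 \<longleftrightarrow> (\<forall>x\<in>\<Omega>.
    \<partial> 1 (\<lambda>y. \<rho> y * u1 y) x + \<partial> 2 (\<lambda>y. \<rho> y * u2 y) x + \<partial> 3 (\<lambda>y. \<rho> y * u3 y) x = 0 \<and>
    \<partial> 1 (\<lambda>y. \<rho> y * (u1 y)\<^sup>2) x + \<partial> 2 (\<lambda>y. \<rho> y * u1 y * u2 y) x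
      + \<partial> 3 (\<lambda>y. \<rho> y * u1 y * u3 y) x + \<partial> 1 (\<lambda>y. pressure \<gamma> (\<rho> y)) x = 0 \<and>
    \<partial> 1 (\<lambda>y. \<rho> y * u1 y * u2 y) x + \<partial> 2 (\<lambda>y. \<rho> y * (u2 y)\<^sup>2) x
      + \<partial> 3 (\<lambda>y. \<rho> y * u2 y * u3 y) x + \<partial> 2 (\<lambda>y. pressure \<gamma> (\<rho> y)) x = 0 \<and>
    \<partial> 1 (\<lambda>y. \<rho> y * u1 y * u3 y) x + \<partial> 2 (\<lambda>y. \<rho> y * u2 y * u3 y) x
      + \<partial> 3 (\<lambda>y. \<rho> y * (u3 y)\<^sup>2) x + \<partial> 3 (\<lambda>y. pressure \<gamma> (\<rho> y)) x = 0)"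

definition bernoulli ::
    "(real \<Rightarrow> real) \<Rightarrow> (real^3 \<Rightarrow> real) \<Rightarrow> (real^3 \<Rightarrow> real) \<Rightarrow> (real^3 \<Rightarrow> real) \<Rightarrow> (real^3 \<Rightarrow> real)
      \<Rightarrow> real^3 \<Rightarrow> real"
  where "bernoulli h \<rho> u1 u2 u3 x = ((u1 x)\<^sup>2 + (u2 x)\<^sup>2 + (u3 x)\<^sup>2) / 2 + h (\<rho> x)"

definition D_flow :: "(real^3 \<Rightarrow> real) \<Rightarrow> (real^3 \<Rightarrow> real) \<Rightarrow> (real^3 \<Rightarrow> real) \<Rightarrow> real^3 \<Rightarrow> real"
  where "D_flow \<beta>2 \<beta>3 f x = \<partial> 1 f x + \<beta>2 x * \<partial> 2 f x + \<beta>3 x * \<partial> 3 f x"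

definition W_flow :: "(real^3 \<Rightarrow> real) \<Rightarrow> (real^3 \<Rightarrow> real) \<Rightarrow> real^3 \<Rightarrow> real"
  where "W_flow \<beta>2 \<beta>3 x =
    \<partial> 2 \<beta>3 x - \<partial> 3 \<beta>2 x + \<beta>3 x * \<partial> 1 \<beta>2 x - \<beta>2 x * \<partial> 1 \<beta>3 x"

end

theory Submission
  imports Defs
begin

text \<open>
  Write \<open>U\<close> for the velocity field. The quantity \<open>W\<close> is the normalized helicity density
  \<open>(U \<cdot> curl U) / u\<^sub>1\<^sup>2\<close> (lemma \<open>W_flow_eq_helicity\<close>) and \<open>G = |U|\<^sup>2 / u\<^sub>1\<^sup>2\<close>, so
  \<open>W / (\<rho> G) = (U \<cdot> curl U) / (\<rho> |U|\<^sup>2)\<close>. Up to the factor \<open>u\<^sub>1\<close>, \<open>D\<close> is the derivative along \<open>U\<close>.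

  The Euler system says that \<open>\<rho> U\<close> is divergence free and that Crocco's relation
  \<open>\<nabla>B = U \<times> curl U\<close> holds (lemma \<open>steady_euler_mass_and_crocco\<close>). Crossing the latter with \<open>U\<close>
  expresses \<open>curl U\<close> as \<open>W / (\<rho> G)\<close> times \<open>\<rho> U\<close> minus \<open>(U \<times> \<nabla>B) / |U|\<^sup>2\<close>. The vorticity has no
  divergence, so taking the divergence of this formula gives
  \<open>\<rho> U \<cdot> \<nabla>(W / (\<rho> G)) = \<nabla>(1 / |U|\<^sup>2) \<cdot> (U \<times> \<nabla>B)\<close> (lemma \<open>helicity_transport\<close>). Since
  \<open>|U|\<^sup>2 = 2 (B - h)\<close>, the gradient on the right is a combination of \<open>\<nabla>B\<close>, which drops out of the
  triple product, and \<open>\<nabla>h = (c\<^sup>2 / \<rho>) \<nabla>\<rho>\<close>. This is the second form of the claim; the quotient rule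
  (lemma \<open>D_flow_quotient\<close>) turns it into the first.

  The analytic input is the symmetry of second derivatives (lemma \<open>partial_deriv_commute\<close>), which is
  needed for \<open>div curl U = 0\<close> and for \<open>curl \<nabla>B = 0\<close>.
\<close>

section \<open>Partial derivatives\<close>

lemma has_real_derivative_along_axis:
  fixes f :: "real^'n \<Rightarrow> real"
  assumes "(f has_derivative f') (at (y + s *\<^sub>R axis i 1))"
  shows "((\<lambda>t. f (y + t *\<^sub>R axis i 1)) has_real_derivative f' (axis i 1)) (at s)"
proof -
  have "((\<lambda>t. y + t *\<^sub>R axis i 1) has_derivative (\<lambda>t. t *\<^sub>R axis i 1)) (at s)"
    by (auto intro!: derivative_eq_intros)
  from has_derivative_compose[OF this assms]
  have "((\<lambda>t. f (y + t *\<^sub>R axis i 1)) has_derivative (\<lambda>t. f' (t *\<^sub>R axis i 1))) (at s)" .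
  moreover have "f' (t *\<^sub>R axis i 1) = f' (axis i 1) * t" for t
    using linear_cmul[OF has_derivative_linear[OF assms]] by simp
  ultimately show ?thesis
    by (simp add: has_field_derivative_def)
qed

lemma partial_deriv_eq:
  fixes f :: "real^'n \<Rightarrow> real"
  assumes "(f has_derivative f') (at x)"
  shows "\<partial> i f x = f' (axis i 1)"
  unfolding partial_deriv_def
  using has_real_derivative_along_axis[of f f' x 0 i] assms by (simp add: DERIV_imp_deriv)

lemma has_derivative_frechet:
  "f differentiable (at x) \<Longrightarrow> (f has_derivative frechet_derivative f (at x)) (at x)"
  by (simp add: frechet_derivative_works)

lemma partial_deriv_frechet:
  fixes f :: "real^'n \<Rightarrow> real"
  shows "f differentiable (at x) \<Longrightarrow> \<partial> i f x = frechet_derivative f (at x) (axis i 1)"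
  by (intro partial_deriv_eq has_derivative_frechet)

lemma partial_deriv_cong_open:
  fixes f g :: "real^'n \<Rightarrow> real"
  assumes "open S" "x \<in> S" "\<And>y. y \<in> S \<Longrightarrow> f y = g y"
  shows "\<partial> i f x = \<partial> i g x"
  unfolding partial_deriv_def
proof (rule deriv_cong_ev)
  have "((\<lambda>t. x + t *\<^sub>R axis i 1) \<longlongrightarrow> x + 0 *\<^sub>R axis i 1) (nhds (0::real))"
    by (intro tendsto_intros) (simp add: filterlim_ident)
  then have "\<forall>\<^sub>F t in nhds 0. x + t *\<^sub>R axis i 1 \<in> S"
    using assms(1,2) by (intro topological_tendstoD) auto
  then show "\<forall>\<^sub>F t in nhds 0. f (x + t *\<^sub>R axis i 1) = g (x + t *\<^sub>R axis i 1)"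
    by eventually_elim (use assms(3) in auto)
qed simp

lemma differentiable_cong_open:
  assumes "f differentiable (at x)" "open S" "x \<in> S" "\<And>y. y \<in> S \<Longrightarrow> f y = g y"
  shows "g differentiable (at x)"
  using assms has_derivative_transform_within_open unfolding differentiable_def by metis

context
  fixes f g :: "real^'n \<Rightarrow> real" and x :: "real^'n"
  assumes f: "f differentiable (at x)" and g: "g differentiable (at x)"
begin

lemma partial_deriv_add: "\<partial> i (\<lambda>y. f y + g y) x = \<partial> i f x + \<partial> i g x"
  using partial_deriv_eq[OF has_derivative_add[OF f[THEN has_derivative_frechet] g[THEN has_derivative_frechet]]]
  by (simp add: partial_deriv_frechet f g)

lemma partial_deriv_diff: "\<partial> i (\<lambda>y. f y - g y) x = \<partial> i f x - \<partial> i g x"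
  using partial_deriv_eq[OF has_derivative_diff[OF f[THEN has_derivative_frechet] g[THEN has_derivative_frechet]]]
  by (simp add: partial_deriv_frechet f g)

lemma partial_deriv_mult: "\<partial> i (\<lambda>y. f y * g y) x = f x * \<partial> i g x + \<partial> i f x * g x"
  using partial_deriv_eq[OF has_derivative_mult[OF f[THEN has_derivative_frechet] g[THEN has_derivative_frechet]]]
  by (simp add: partial_deriv_frechet f g)

end

lemma partial_deriv_compose:
  fixes f :: "real^'n \<Rightarrow> real"
  assumes "f differentiable (at x)" "(g has_real_derivative d) (at (f x))"
  shows "\<partial> i (\<lambda>y. g (f y)) x = d * \<partial> i f x"
    and "(\<lambda>y. g (f y)) differentiable (at x)"
proof -
  have *: "((\<lambda>y. g (f y)) has_derivative (\<lambda>v. d * frechet_derivative f (at x) v)) (at x)"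
    using has_derivative_compose[OF has_derivative_frechet[OF assms(1)]] assms(2)
    by (auto simp: has_field_derivative_def)
  show "\<partial> i (\<lambda>y. g (f y)) x = d * \<partial> i f x"
    using partial_deriv_eq[OF *] by (simp add: partial_deriv_frechet assms(1))
  show "(\<lambda>y. g (f y)) differentiable (at x)"
    using * by (rule differentiableI)
qed

lemma partial_deriv_square:
  fixes f :: "real^'n \<Rightarrow> real"
  assumes "f differentiable (at x)"
  shows "\<partial> i (\<lambda>y. (f y)\<^sup>2) x = 2 * f x * \<partial> i f x"
  by (simp add: power2_eq_square partial_deriv_mult assms)

lemma partial_deriv_divide:
  fixes f g :: "real^'n \<Rightarrow> real"
  assumes "f differentiable (at x)" "g differentiable (at x)" "g x \<noteq> 0"
  shows "\<partial> i (\<lambda>y. f y / g y) x = (\<partial> i f x * g x - f x * \<partial> i g x) / (g x)\<^sup>2"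
proof -
  have "(inverse has_real_derivative - (inverse (g x) ^ Suc (Suc 0))) (at (g x))"
    by (rule DERIV_inverse[OF assms(3)])
  note inv = partial_deriv_compose[OF assms(2) this]
  show ?thesis
    by (simp add: divide_inverse partial_deriv_mult assms inv)
       (use assms(3) in \<open>simp add: field_simps power2_eq_square\<close>)
qed

lemma partial_deriv_ln:
  fixes f :: "real^'n \<Rightarrow> real"
  assumes "f differentiable (at x)" "f x > 0"
  shows "\<partial> i (\<lambda>y. ln (f y)) x = \<partial> i f x / f x"
  using partial_deriv_compose(1)[OF assms(1) DERIV_ln[OF assms(2)]] by (simp add: divide_inverse)

text \<open>Reading the second difference as the increment over one step of
  \<open>s \<mapsto> f (x + s e\<^sub>i + t e\<^sub>j) - f (x + s e\<^sub>i)\<close>, the mean value theorem turns it into \<open>t\<close> times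
  a difference of two values of \<open>\<partial> i f\<close> at points \<open>O(t)\<close> away from \<open>x\<close>. The linearization of
  \<open>\<partial> i f\<close> at \<open>x\<close> evaluates this difference up to \<open>o(t)\<close>.\<close>
lemma second_difference_tendsto:
  fixes f :: "real^'n \<Rightarrow> real"
  assumes S: "open S" "x \<in> S" and f: "\<And>y. y \<in> S \<Longrightarrow> f differentiable (at y)"
    and fi: "(\<partial> i f) differentiable (at x)"
  shows "((\<lambda>t. (f (x + t *\<^sub>R axis i 1 + t *\<^sub>R axis j 1) - f (x + t *\<^sub>R axis i 1)
              - f (x + t *\<^sub>R axis j 1) + f x) / t\<^sup>2)
          \<longlongrightarrow> \<partial> j (\<partial> i f) x) (at_right 0)"
proof (rule tendstoI)
  fix e :: real assume "e > 0"
  define L where "L = frechet_derivative (\<partial> i f) (at x)"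
  have L: "(\<partial> i f has_derivative L) (at x)"
    using fi unfolding L_def by (rule has_derivative_frechet)
  then obtain d where d: "d > 0" and
    dL: "\<And>y. norm (y - x) < d \<Longrightarrow> \<bar>\<partial> i f y - \<partial> i f x - L (y - x)\<bar> \<le> e / 4 * norm (y - x)"
    unfolding has_derivative_at_alt real_norm_def using \<open>e > 0\<close> by (metis divide_pos_pos zero_less_numeral)
  obtain r where r: "r > 0" "ball x r \<subseteq> S"
    using S openE by blast
  have lin: "linear L" using L by (rule has_derivative_linear)
  have "\<bar>(f (x + t *\<^sub>R axis i 1 + t *\<^sub>R axis j 1) - f (x + t *\<^sub>R axis i 1)
              - f (x + t *\<^sub>R axis j 1) + f x) / t\<^sup>2 - \<partial> j (\<partial> i f) x\<bar> < e"
    if t: "0 < t" "t < min d r / 2" for t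
  proof -
    define g where "g s = f (x + s *\<^sub>R axis i 1 + t *\<^sub>R axis j 1) - f (x + s *\<^sub>R axis i 1)" for s
    have n1: "norm (s *\<^sub>R axis i 1 + t *\<^sub>R axis j (1::real)) \<le> 2 * t" if "0 \<le> s" "s \<le> t" for s
      using norm_triangle_ineq[of "s *\<^sub>R axis i 1" "t *\<^sub>R axis j (1::real)"] that t by simp
    have n2: "norm (s *\<^sub>R axis i (1::real)) \<le> t" if "0 \<le> s" "s \<le> t" for s
      using that by simp
    have m1: "x + s *\<^sub>R axis i 1 + t *\<^sub>R axis j 1 \<in> S" if "0 \<le> s" "s \<le> t" for s
      using n1[OF that] t r by (intro subsetD[OF r(2)]) (auto simp: dist_norm norm_minus_commute add.commute add.left_commute)
    have m2: "x + s *\<^sub>R axis i 1 \<in> S" if "0 \<le> s" "s \<le> t" for s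
      using n2[OF that] t r by (intro subsetD[OF r(2)]) (auto simp: dist_norm)
    have along: "((\<lambda>s. f (y + s *\<^sub>R axis i 1)) has_real_derivative \<partial> i f (y + s *\<^sub>R axis i 1)) (at s)"
      if y: "y + s *\<^sub>R axis i 1 \<in> S" for y s
      using has_real_derivative_along_axis[OF has_derivative_frechet[OF f[OF y]]]
      by (simp add: partial_deriv_frechet[OF f[OF y]])
    have dg: "(g has_real_derivative
        (\<partial> i f (x + s *\<^sub>R axis i 1 + t *\<^sub>R axis j 1) - \<partial> i f (x + s *\<^sub>R axis i 1))) (at s)"
      if "0 \<le> s" "s \<le> t" for s
      unfolding g_def
      using DERIV_diff[OF along[of "x + t *\<^sub>R axis j 1" s] along[of x s]] m1[OF that] m2[OF that]
      by (simp add: algebra_simps)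
    obtain s where s: "0 < s" "s < t" and gs: "g t - g 0 = (t - 0) *
        (\<partial> i f (x + s *\<^sub>R axis i 1 + t *\<^sub>R axis j 1) - \<partial> i f (x + s *\<^sub>R axis i 1))"
      using MVT2[OF t(1), of g "\<lambda>s. \<partial> i f (x + s *\<^sub>R axis i 1 + t *\<^sub>R axis j 1) - \<partial> i f (x + s *\<^sub>R axis i 1)"] dg by blast
    define a where "a = s *\<^sub>R axis i 1 + t *\<^sub>R axis j (1::real)"
    define b where "b = s *\<^sub>R axis i (1::real)"
    \<comment> \<open>Here \<open>|a| \<le> 2 t\<close> and \<open>|b| \<le> t\<close>, so the linearization errors add up to at most three
      quarters of \<open>e t\<close>.\<close>
    have "\<bar>\<partial> i f (x + a) - \<partial> i f x - L a\<bar> \<le> e / 4 * norm a"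
      using dL[of "x + a"] n1[of s] s t unfolding a_def by auto
    also have "\<dots> \<le> e / 4 * (2 * t)"
      unfolding a_def using n1[of s] s \<open>e > 0\<close> by (intro mult_left_mono) auto
    finally have La: "\<bar>\<partial> i f (x + a) - \<partial> i f x - L a\<bar> \<le> 2 * (e / 4 * t)"
      by simp
    have "\<bar>\<partial> i f (x + b) - \<partial> i f x - L b\<bar> \<le> e / 4 * norm b"
      using dL[of "x + b"] n2[of s] s t unfolding b_def by auto
    also have "\<dots> \<le> e / 4 * t"
      unfolding b_def using n2[of s] s \<open>e > 0\<close> by (intro mult_left_mono) auto
    finally have Lb: "\<bar>\<partial> i f (x + b) - \<partial> i f x - L b\<bar> \<le> e / 4 * t" .
    have "L a - L b = t * L (axis j 1)"
      unfolding a_def b_def by (simp add: linear_add[OF lin] linear_cmul[OF lin])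
    with La Lb have "\<bar>\<partial> i f (x + a) - \<partial> i f (x + b) - t * L (axis j 1)\<bar> \<le> 3 * (e / 4 * t)"
      by linarith
    then have "\<bar>(\<partial> i f (x + a) - \<partial> i f (x + b)) / t - L (axis j 1)\<bar> \<le> 3 / 4 * e"
      using t(1) by (simp add: abs_le_iff field_simps)
    moreover have "f (x + t *\<^sub>R axis i 1 + t *\<^sub>R axis j 1) - f (x + t *\<^sub>R axis i 1)
              - f (x + t *\<^sub>R axis j 1) + f x = t * (\<partial> i f (x + a) - \<partial> i f (x + b))"
      using gs unfolding g_def a_def b_def by (simp add: add.assoc)
    ultimately show ?thesis
      using \<open>e > 0\<close> t(1) partial_deriv_eq[OF L, of j] by (simp add: power2_eq_square)
  qed
  then show "\<forall>\<^sub>F t in at_right 0. dist ((f (x + t *\<^sub>R axis i 1 + t *\<^sub>R axis j 1)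
      - f (x + t *\<^sub>R axis i 1) - f (x + t *\<^sub>R axis j 1) + f x) / t\<^sup>2) (\<partial> j (\<partial> i f) x) < e"
    using d r by (intro eventually_at_rightI[of 0 "min d r / 2"]) (auto simp: dist_real_def)
qed

text \<open>The second difference is symmetric in \<open>i\<close> and \<open>j\<close>. Stated under pointwise differentiability
  of the first derivatives, because this is the regularity that Crocco's relation yields for the
  Bernoulli function.\<close>
lemma partial_deriv_commute:
  fixes f :: "real^'n \<Rightarrow> real"
  assumes "open S" "x \<in> S" "\<And>y. y \<in> S \<Longrightarrow> f differentiable (at y)"
    and "(\<partial> i f) differentiable (at x)" "(\<partial> j f) differentiable (at x)"
  shows "\<partial> i (\<partial> j f) x = \<partial> j (\<partial> i f) x"
proof (rule tendsto_unique[OF _ second_difference_tendsto[OF assms(1-3,5)]])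
  show "((\<lambda>t. (f (x + t *\<^sub>R axis j 1 + t *\<^sub>R axis i 1) - f (x + t *\<^sub>R axis j 1)
              - f (x + t *\<^sub>R axis i 1) + f x) / t\<^sup>2)
          \<longlongrightarrow> \<partial> j (\<partial> i f) x) (at_right 0)"
    using second_difference_tendsto[OF assms(1-4), of j] by (simp add: algebra_simps)
qed simp

section \<open>Vector calculus in three dimensions\<close>

unbundle cross3_syntax

definition divergence :: "(real^3 \<Rightarrow> real^3) \<Rightarrow> real^3 \<Rightarrow> real"
  where "divergence V x = (\<Sum>i\<in>UNIV. \<partial> i (\<lambda>y. V y $ i) x)"

definition curl :: "(real^3 \<Rightarrow> real^3) \<Rightarrow> real^3 \<Rightarrow> real^3"
  where "curl V x = vector
    [\<partial> 2 (\<lambda>y. V y $ 3) x - \<partial> 3 (\<lambda>y. V y $ 2) x,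
     \<partial> 3 (\<lambda>y. V y $ 1) x - \<partial> 1 (\<lambda>y. V y $ 3) x,
     \<partial> 1 (\<lambda>y. V y $ 2) x - \<partial> 2 (\<lambda>y. V y $ 1) x]"

lemma differentiable_vec_iff:
  fixes V :: "'a::real_normed_vector \<Rightarrow> real^'n"
  shows "V differentiable (at x) \<longleftrightarrow> (\<forall>i. (\<lambda>y. V y $ i) differentiable (at x))"
proof
  assume "V differentiable (at x)"
  then show "\<forall>i. (\<lambda>y. V y $ i) differentiable (at x)"
    unfolding differentiable_def
    using bounded_linear.has_derivative[OF bounded_linear_vec_nth] by blast
next
  assume *: "\<forall>i. (\<lambda>y. V y $ i) differentiable (at x)"
  have "(\<lambda>y. \<Sum>i\<in>UNIV. (V y $ i) *\<^sub>R axis i (1::real)) differentiable (at x)"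
    using * by (intro differentiable_sum differentiable_scaleR differentiable_const) auto
  moreover have "(\<lambda>y. \<Sum>i\<in>UNIV. (V y $ i) *\<^sub>R axis i (1::real)) = V"
    using basis_expansion[of "V y" for y] by (auto simp: scalar_mult_eq_scaleR)
  ultimately show "V differentiable (at x)" by simp
qed

lemma differentiable_vec_nth:
  fixes V :: "'a::real_normed_vector \<Rightarrow> real^'n"
  shows "V differentiable (at x) \<Longrightarrow> (\<lambda>y. V y $ i) differentiable (at x)"
  by (simp add: differentiable_vec_iff)

lemma differentiable_cross3:
  fixes V Z :: "'a::real_normed_vector \<Rightarrow> real^3"
  assumes "V differentiable (at x)" "Z differentiable (at x)"
  shows "(\<lambda>y. V y \<times> Z y) differentiable (at x)"
  using assms by (simp add: differentiable_vec_iff forall_3 cross_components)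

lemma divergence_scaleR:
  assumes "f differentiable (at x)" "V differentiable (at x)"
  shows "divergence (\<lambda>y. f y *\<^sub>R V y) x = grad f x \<bullet> V x + f x * divergence V x"
  using assms
  by (simp add: divergence_def grad_def inner_vec_def partial_deriv_mult differentiable_vec_nth
      sum.distrib sum_distrib_left algebra_simps)

lemma divergence_diff:
  assumes "V differentiable (at x)" "Z differentiable (at x)"
  shows "divergence (\<lambda>y. V y - Z y) x = divergence V x - divergence Z x"
  using assms by (simp add: divergence_def partial_deriv_diff differentiable_vec_nth sum_subtractf)

lemma divergence_cross3:
  assumes "V differentiable (at x)" "Z differentiable (at x)"
  shows "divergence (\<lambda>y. V y \<times> Z y) x = Z x \<bullet> curl V x - V x \<bullet> curl Z x"
  using assms
  by (simp add: divergence_def curl_def sum_3 inner_vec_def cross_components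
      partial_deriv_mult partial_deriv_diff differentiable_vec_nth algebra_simps)

lemma divergence_cong_open:
  assumes "open S" "x \<in> S" "\<And>y. y \<in> S \<Longrightarrow> V y = Z y"
  shows "divergence V x = divergence Z x"
  unfolding divergence_def
  by (intro sum.cong refl partial_deriv_cong_open[OF assms(1,2)]) (simp add: assms(3))

lemma curl_grad:
  assumes "open S" "x \<in> S" "\<And>y. y \<in> S \<Longrightarrow> f differentiable (at y)"
    and "(grad f) differentiable (at x)"
  shows "curl (grad f) x = 0"
proof -
  have "(\<partial> i f) differentiable (at x)" for i
    using differentiable_vec_nth[OF assms(4), of i] by (simp add: grad_def)
  then have "\<partial> i (\<partial> j f) x = \<partial> j (\<partial> i f) x" for i j
    by (intro partial_deriv_commute[OF assms(1-3)])
  from this[of 1 2] this[of 1 3] this[of 2 3] show ?thesis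
    by (simp add: curl_def grad_def vec_eq_iff forall_3)
qed

lemma differentiable_curl:
  assumes "\<And>i j. (\<partial> j (\<lambda>z. V z $ i)) differentiable (at x)"
  shows "curl V differentiable (at x)"
  unfolding curl_def by (simp add: differentiable_vec_iff forall_3 assms)

lemma divergence_curl:
  assumes "open S" "x \<in> S" "\<And>y. y \<in> S \<Longrightarrow> V differentiable (at y)"
    and V2: "\<And>i j. (\<partial> j (\<lambda>z. V z $ i)) differentiable (at x)"
  shows "divergence (curl V) x = 0"
proof -
  have "\<partial> i (\<partial> j (\<lambda>z. V z $ k)) x = \<partial> j (\<partial> i (\<lambda>z. V z $ k)) x" for i j k
    using assms(3) by (intro partial_deriv_commute[OF assms(1,2)] V2) (simp add: differentiable_vec_nth)
  from this[of 1 2 3] this[of 1 3 2] this[of 2 3 1] show ?thesis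
    by (simp add: divergence_def sum_3 curl_def partial_deriv_diff V2)
qed

section \<open>Transport of helicity\<close>

text \<open>Crossing \<open>\<nabla>B = U \<times> curl U\<close> with \<open>U\<close> resolves the vorticity along and across the flow:
  \<open>curl U = m \<rho> U - n (U \<times> \<nabla>B)\<close> with \<open>m = (U \<cdot> curl U) / (\<rho> |U|\<^sup>2)\<close> and \<open>n = 1 / |U|\<^sup>2\<close>.
  The left side and \<open>\<rho> U\<close> are divergence free, so the divergence of this identity is
  \<open>\<rho> U \<cdot> \<nabla>m = div (n (U \<times> \<nabla>B))\<close>. Finally \<open>U \<times> \<nabla>B\<close> is itself divergence free:
  \<open>curl \<nabla>B = 0\<close>, and \<open>\<nabla>B\<close> is orthogonal to \<open>curl U\<close>.\<close>
lemma helicity_transport: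
  fixes U :: "real^3 \<Rightarrow> real^3" and \<rho> B :: "real^3 \<Rightarrow> real"
  assumes S: "open S" "x \<in> S"
    and U: "\<And>y. y \<in> S \<Longrightarrow> U differentiable (at y)"
    and U2: "\<And>i j. (\<partial> j (\<lambda>z. U z $ i)) differentiable (at x)"
    and B: "\<And>y. y \<in> S \<Longrightarrow> B differentiable (at y)"
    and \<rho>: "\<rho> differentiable (at x)"
    and nz: "\<And>y. y \<in> S \<Longrightarrow> \<rho> y \<noteq> 0" "\<And>y. y \<in> S \<Longrightarrow> U y \<noteq> 0"
    and mass: "divergence (\<lambda>y. \<rho> y *\<^sub>R U y) x = 0"
    and crocco: "\<And>y. y \<in> S \<Longrightarrow> grad B y = U y \<times> curl U y"
  shows "\<rho> x * (U x \<bullet> grad (\<lambda>y. (U y \<bullet> curl U y) / (\<rho> y * (U y \<bullet> U y))) x)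
       = grad (\<lambda>y. inverse (U y \<bullet> U y)) x \<bullet> (U x \<times> grad B x)"
proof -
  define m where "m = (\<lambda>y. (U y \<bullet> curl U y) / (\<rho> y * (U y \<bullet> U y)))"
  define n where "n = (\<lambda>y. inverse (U y \<bullet> U y))"
  note Ux = U[OF S(2)] and nx = nz[OF S(2)]
  have curl_diff: "curl U differentiable (at x)"
    by (rule differentiable_curl[OF U2])
  \<comment> \<open>\<open>B\<close> is only assumed to be differentiable; one more derivative comes from its gradient being
    \<open>U \<times> curl U\<close>.\<close>
  have gradB: "grad B differentiable (at x)"
    using S differentiable_cross3[OF Ux curl_diff] crocco
    by (auto intro: differentiable_cong_open)
  have m: "m differentiable (at x)"
    unfolding m_def using nx Ux curl_diff \<rho>
    by (intro differentiable_divide differentiable_mult differentiable_inner) auto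
  have n: "n differentiable (at x)"
    unfolding n_def using nx Ux by (intro differentiable_inverse differentiable_inner) auto
  have F: "(\<lambda>y. \<rho> y *\<^sub>R U y) differentiable (at x)"
    by (intro differentiable_scaleR \<rho> Ux)
  have C: "(\<lambda>y. U y \<times> grad B y) differentiable (at x)"
    by (intro differentiable_cross3 Ux gradB)
  have split: "curl U y = m y *\<^sub>R (\<rho> y *\<^sub>R U y) - n y *\<^sub>R (U y \<times> grad B y)" if y: "y \<in> S" for y
  proof -
    have "U y \<times> grad B y = (U y \<bullet> curl U y) *\<^sub>R U y - (U y \<bullet> U y) *\<^sub>R curl U y"
      unfolding crocco[OF y] by (rule Lagrange)
    then show ?thesis
      using nz[OF y] by (simp add: m_def n_def scaleR_diff_right divide_inverse_commute)
  qed
  have "0 = divergence (curl U) x"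
    by (rule divergence_curl[symmetric, OF S U U2])
  also have "\<dots> = divergence (\<lambda>y. m y *\<^sub>R (\<rho> y *\<^sub>R U y) - n y *\<^sub>R (U y \<times> grad B y)) x"
    by (rule divergence_cong_open[OF S split])
  also have "\<dots> = grad m x \<bullet> (\<rho> x *\<^sub>R U x) - (grad n x \<bullet> (U x \<times> grad B x)
      + n x * divergence (\<lambda>y. U y \<times> grad B y) x)"
    using mass by (simp add: divergence_diff divergence_scaleR differentiable_scaleR m n F C
        del: scaleR_scaleR)
  also have "divergence (\<lambda>y. U y \<times> grad B y) x = 0"
    using curl_grad[OF S B gradB] crocco[OF S(2)]
    by (simp add: divergence_cross3 Ux gradB dot_cross_self)
  finally show ?thesis
    by (simp add: m_def n_def inner_commute)
qed

section \<open>The Euler system\<close>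

lemma smooth_on_differentiable:
  assumes "smooth_on S f" "x \<in> S"
  shows "f differentiable (at x)" "(\<partial> i f) differentiable (at x)"
proof -
  have "Ck_on (Suc (Suc 0)) f S"
    using assms(1) unfolding smooth_on_def by blast
  then show "f differentiable (at x)" "(\<partial> i f) differentiable (at x)"
    using assms(2) by auto
qed

lemma pressure_has_derivative:
  assumes "\<gamma> \<noteq> 0" "r > 0"
  shows "(pressure \<gamma> has_real_derivative deriv (pressure \<gamma>) r) (at r)"
    and "(sound_speed \<gamma> r)\<^sup>2 = deriv (pressure \<gamma>) r"
proof -
  have *: "(pressure \<gamma> has_real_derivative r powr (\<gamma> - 1)) (at r)"
    unfolding pressure_def[abs_def] using assms
    by (auto intro!: derivative_eq_intros)
  show "(pressure \<gamma> has_real_derivative deriv (pressure \<gamma>) r) (at r)"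
    using * DERIV_imp_deriv[OF *] by simp
  show "(sound_speed \<gamma> r)\<^sup>2 = deriv (pressure \<gamma>) r"
    unfolding sound_speed_def DERIV_imp_deriv[OF *] by simp
qed

lemma is_enthalpy_has_derivative:
  assumes "is_enthalpy \<gamma> h" "\<gamma> \<noteq> 0" "r > 0"
  shows "(h has_real_derivative (sound_speed \<gamma> r)\<^sup>2 / r) (at r)"
  using assms by (simp add: is_enthalpy_def pressure_has_derivative)

lemma bernoulli_partial_deriv:
  assumes "is_enthalpy \<gamma> h" "\<gamma> \<noteq> 0" "\<rho> x > 0"
    and "\<rho> differentiable (at x)" "u1 differentiable (at x)"
      "u2 differentiable (at x)" "u3 differentiable (at x)"
  shows "\<partial> i (bernoulli h \<rho> u1 u2 u3) x
      = u1 x * \<partial> i u1 x + u2 x * \<partial> i u2 x + u3 x * \<partial> i u3 x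
        + (sound_speed \<gamma> (\<rho> x))\<^sup>2 / \<rho> x * \<partial> i \<rho> x"
    and "bernoulli h \<rho> u1 u2 u3 differentiable (at x)"
proof -
  note h = partial_deriv_compose[OF assms(4) is_enthalpy_has_derivative[OF assms(1-3)]]
  have half: "bernoulli h \<rho> u1 u2 u3
      = (\<lambda>y. ((u1 y)\<^sup>2 + (u2 y)\<^sup>2 + (u3 y)\<^sup>2) / 2 + h (\<rho> y))"
    by (simp add: bernoulli_def fun_eq_iff)
  have const: "\<partial> i (\<lambda>y. c) x = 0" for c :: real and i :: 3
    by (simp add: partial_deriv_frechet)
  show "\<partial> i (bernoulli h \<rho> u1 u2 u3) x
      = u1 x * \<partial> i u1 x + u2 x * \<partial> i u2 x + u3 x * \<partial> i u3 x
        + (sound_speed \<gamma> (\<rho> x))\<^sup>2 / \<rho> x * \<partial> i \<rho> x"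
    unfolding half
    by (simp add: partial_deriv_add partial_deriv_divide partial_deriv_square const h assms)
  show "bernoulli h \<rho> u1 u2 u3 differentiable (at x)"
    unfolding half by (simp add: h assms)
qed

text \<open>Subtracting \<open>u\<^sub>i\<close> times the mass equation from the conservative momentum equation leaves
  \<open>\<rho> (U \<cdot> \<nabla>) u\<^sub>i + \<partial>\<^sub>i p = 0\<close>. Since \<open>\<nabla>p = \<rho> \<nabla>h\<close>, this is \<open>(U \<cdot> \<nabla>) U = - \<nabla>h\<close>, and Lamb's identity
  \<open>(U \<cdot> \<nabla>) U = \<nabla>(|U|\<^sup>2 / 2) - U \<times> curl U\<close> gives Crocco's relation.\<close>
lemma steady_euler_mass_and_crocco:
  fixes \<rho> u1 u2 u3 :: "real^3 \<Rightarrow> real"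
  defines "U \<equiv> \<lambda>y. vector [u1 y, u2 y, u3 y] :: real^3"
  assumes h: "is_enthalpy \<gamma> h" and \<gamma>: "\<gamma> \<noteq> 0" and \<rho>: "\<rho> x > 0"
    and d: "\<rho> differentiable (at x)" "u1 differentiable (at x)"
      "u2 differentiable (at x)" "u3 differentiable (at x)"
    and euler: "steady_euler S \<gamma> \<rho> u1 u2 u3" and x: "x \<in> S"
  shows "divergence (\<lambda>y. \<rho> y *\<^sub>R U y) x = 0"
    and "grad (bernoulli h \<rho> u1 u2 u3) x = U x \<times> curl U x"
proof -
  define a where "a = (sound_speed \<gamma> (\<rho> x))\<^sup>2"
  have p: "\<partial> i (\<lambda>y. pressure \<gamma> (\<rho> y)) x = a * \<partial> i \<rho> x" for i
    using partial_deriv_compose(1)[OF d(1) pressure_has_derivative(1)[OF \<gamma> \<rho>]]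
    by (simp add: a_def pressure_has_derivative(2)[OF \<gamma> \<rho>])
  have mass: "\<partial> 1 (\<lambda>y. \<rho> y * u1 y) x + \<partial> 2 (\<lambda>y. \<rho> y * u2 y) x + \<partial> 3 (\<lambda>y. \<rho> y * u3 y) x = 0"
    using euler x by (simp add: steady_euler_def)
  then show "divergence (\<lambda>y. \<rho> y *\<^sub>R U y) x = 0"
    by (simp add: divergence_def sum_3 U_def)
  have eqs: "\<partial> 1 (\<lambda>y. \<rho> y * u1 y * u1 y) x + \<partial> 2 (\<lambda>y. \<rho> y * u2 y * u1 y) x
      + \<partial> 3 (\<lambda>y. \<rho> y * u3 y * u1 y) x + a * \<partial> 1 \<rho> x = 0"
    "\<partial> 1 (\<lambda>y. \<rho> y * u1 y * u2 y) x + \<partial> 2 (\<lambda>y. \<rho> y * u2 y * u2 y) x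
      + \<partial> 3 (\<lambda>y. \<rho> y * u3 y * u2 y) x + a * \<partial> 2 \<rho> x = 0"
    "\<partial> 1 (\<lambda>y. \<rho> y * u1 y * u3 y) x + \<partial> 2 (\<lambda>y. \<rho> y * u2 y * u3 y) x
      + \<partial> 3 (\<lambda>y. \<rho> y * u3 y * u3 y) x + a * \<partial> 3 \<rho> x = 0"
    using euler x by (simp_all add: steady_euler_def p[symmetric] power2_eq_square mult_ac)
  \<comment> \<open>One momentum equation in advective form, where \<open>f\<close> is its velocity component.\<close>
  have momentum: "u1 x * \<partial> 1 f x + u2 x * \<partial> 2 f x + u3 x * \<partial> 3 f x = - (a / \<rho> x * \<partial> i \<rho> x)"
    if f: "f differentiable (at x)" and
      eq: "\<partial> 1 (\<lambda>y. \<rho> y * u1 y * f y) x + \<partial> 2 (\<lambda>y. \<rho> y * u2 y * f y) x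
        + \<partial> 3 (\<lambda>y. \<rho> y * u3 y * f y) x + a * \<partial> i \<rho> x = 0" for f i
  proof -
    have "(\<partial> 1 (\<lambda>y. \<rho> y * u1 y) x + \<partial> 2 (\<lambda>y. \<rho> y * u2 y) x + \<partial> 3 (\<lambda>y. \<rho> y * u3 y) x) * f x
        + \<rho> x * (u1 x * \<partial> 1 f x + u2 x * \<partial> 2 f x + u3 x * \<partial> 3 f x) + a * \<partial> i \<rho> x = 0"
      using eq partial_deriv_mult[OF differentiable_mult[OF d(1,2)] f, of 1]
        partial_deriv_mult[OF differentiable_mult[OF d(1,3)] f, of 2]
        partial_deriv_mult[OF differentiable_mult[OF d(1,4)] f, of 3]
      by (simp add: algebra_simps)
    then have "\<rho> x * (u1 x * \<partial> 1 f x + u2 x * \<partial> 2 f x + u3 x * \<partial> 3 f x) + a * \<partial> i \<rho> x = 0"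
      by (simp add: mass)
    then show ?thesis using \<rho> by (simp add: field_simps)
  qed
  note mom = momentum[OF d(2) eqs(1)] momentum[OF d(3) eqs(2)] momentum[OF d(4) eqs(3)]
  have "\<partial> i (bernoulli h \<rho> u1 u2 u3) x
      = u1 x * \<partial> i u1 x + u2 x * \<partial> i u2 x + u3 x * \<partial> i u3 x + a / \<rho> x * \<partial> i \<rho> x" for i
    unfolding a_def by (rule bernoulli_partial_deriv(1)[OF h \<gamma> \<rho> d])
  from this[of 1] this[of 2] this[of 3] mom
  show "grad (bernoulli h \<rho> u1 u2 u3) x = U x \<times> curl U x"
    by (simp add: vec_eq_iff forall_3 grad_def cross_components curl_def U_def algebra_simps)
qed

text \<open>\<open>W\<close> is \<open>b \<cdot> curl b\<close> for the direction field \<open>b = (1, \<beta>\<^sub>2, \<beta>\<^sub>3) = U / u\<^sub>1\<close>. Rescaling a field by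
  \<open>f\<close> multiplies \<open>b \<cdot> curl b\<close> by \<open>f\<^sup>2\<close>, since the extra term \<open>\<nabla>f \<times> b\<close> of the curl is orthogonal to \<open>b\<close>.\<close>
lemma W_flow_eq_helicity:
  fixes u1 u2 u3 :: "real^3 \<Rightarrow> real"
  defines "U \<equiv> \<lambda>y. vector [u1 y, u2 y, u3 y] :: real^3"
  assumes d: "u1 differentiable (at x)" "u2 differentiable (at x)" "u3 differentiable (at x)"
    and nz: "u1 x \<noteq> 0"
  shows "W_flow (\<lambda>y. u2 y / u1 y) (\<lambda>y. u3 y / u1 y) x = (U x \<bullet> curl U x) / (u1 x)\<^sup>2"
  unfolding W_flow_def
  by (simp add: partial_deriv_divide d nz inner_vec_def sum_3 U_def curl_def)
     (use nz in \<open>simp add: field_simps power2_eq_square\<close>)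

text \<open>The quotient rule, which makes the two forms of the transport equation equivalent.\<close>
lemma D_flow_quotient:
  assumes "W differentiable (at x)" "\<rho> differentiable (at x)" "G differentiable (at x)"
    and "\<rho> x > 0" "G x \<noteq> 0"
  shows "\<rho> x * G x * D_flow b2 b3 (\<lambda>y. W y / (\<rho> y * G y)) x
    = D_flow b2 b3 W x - W x * D_flow b2 b3 (\<lambda>y. ln (\<rho> y)) x
      - inverse (G x) * W x * D_flow b2 b3 G x"
proof -
  have nz: "\<rho> x * G x \<noteq> 0"
    using assms(4,5) by simp
  have "\<rho> x * G x * \<partial> i (\<lambda>y. W y / (\<rho> y * G y)) x
      = \<partial> i W x - W x * \<partial> i (\<lambda>y. ln (\<rho> y)) x - inverse (G x) * W x * \<partial> i G x" for i
    unfolding partial_deriv_divide[OF assms(1) differentiable_mult[OF assms(2,3)] nz]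
      partial_deriv_mult[OF assms(2,3)] partial_deriv_ln[OF assms(2,4)]
    using assms(4,5) by (simp add: field_simps power2_eq_square)
  from this[of 1] this[of 2] this[of 3] show ?thesis
    unfolding D_flow_def by algebra
qed

section \<open>The transport equation for \<open>W\<close>\<close>

theorem theorem3p1:
  fixes \<gamma> :: real and h :: "real \<Rightarrow> real"
    and \<Omega> :: "(real^3) set" and \<rho> u1 u2 u3 :: "real^3 \<Rightarrow> real"
  assumes "1 < \<gamma>" and "\<gamma> < 3"
    and "is_enthalpy \<gamma> h"
    and "open \<Omega>"
    and "smooth_on \<Omega> \<rho>" and "smooth_on \<Omega> u1" and "smooth_on \<Omega> u2" and "smooth_on \<Omega> u3"
    and "\<And>x. x \<in> \<Omega> \<Longrightarrow> \<rho> x > 0" and "\<And>x. x \<in> \<Omega> \<Longrightarrow> u1 x > 0"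
    and "steady_euler \<Omega> \<gamma> \<rho> u1 u2 u3"
  shows
    "let s = (\<lambda>x. ln (\<rho> x));
         \<beta>2 = (\<lambda>x. u2 x / u1 x);
         \<beta>3 = (\<lambda>x. u3 x / u1 x);
         G = (\<lambda>x. 1 + (\<beta>2 x)\<^sup>2 + (\<beta>3 x)\<^sup>2);
         B = bernoulli h \<rho> u1 u2 u3;
         c = sound_speed \<gamma>;
         D = D_flow \<beta>2 \<beta>3;
         W = W_flow \<beta>2 \<beta>3
     in \<forall>x\<in>\<Omega>.
       D W x - W x * D s x - inverse (G x) * W x * D G x
         - (c (\<rho> x))\<^sup>2 * G x / (2 * (B x - h (\<rho> x))\<^sup>2) *
           ((\<partial> 2 B x * \<partial> 3 s x - \<partial> 3 B x * \<partial> 2 s x)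
            + \<beta>2 x * (\<partial> 3 B x * \<partial> 1 s x - \<partial> 1 B x * \<partial> 3 s x)
            + \<beta>3 x * (\<partial> 1 B x * \<partial> 2 s x - \<partial> 2 B x * \<partial> 1 s x)) = 0 \<and>
       D (\<lambda>y. W y / (\<rho> y * G y)) x
         + (c (\<rho> x))\<^sup>2 / (2 * (\<rho> x)\<^sup>2 * (B x - h (\<rho> x))\<^sup>2) *
           (vector [1, \<beta>2 x, \<beta>3 x] \<bullet> cross3 (grad \<rho> x) (grad B x)) = 0"
proof -
  define \<beta>2 where "\<beta>2 = (\<lambda>x. u2 x / u1 x)"
  define \<beta>3 where "\<beta>3 = (\<lambda>x. u3 x / u1 x)"
  define G where "G = (\<lambda>x. 1 + (\<beta>2 x)\<^sup>2 + (\<beta>3 x)\<^sup>2)"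
  define B where "B = bernoulli h \<rho> u1 u2 u3"
  define W where "W = W_flow \<beta>2 \<beta>3"
  define U :: "real^3 \<Rightarrow> real^3" where "U = (\<lambda>y. vector [u1 y, u2 y, u3 y])"
  define n where "n = (\<lambda>y. inverse (U y \<bullet> U y))"
  have \<gamma>: "\<gamma> \<noteq> 0" using assms(1) by simp
  note d = smooth_on_differentiable[OF assms(5)] smooth_on_differentiable[OF assms(6)]
    smooth_on_differentiable[OF assms(7)] smooth_on_differentiable[OF assms(8)]
  note d1 = d(1,3,5,7)
  have U: "U differentiable (at y)" if "y \<in> \<Omega>" for y
    using d1[OF that] by (simp add: U_def differentiable_vec_iff forall_3)
  have U2: "(\<partial> j (\<lambda>z. U z $ i)) differentiable (at y)" if "y \<in> \<Omega>" for y i j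
    using d[OF that] exhaust_3[of i] by (auto simp: U_def)
  have B: "B differentiable (at y)" if "y \<in> \<Omega>" for y
    unfolding B_def
    by (rule bernoulli_partial_deriv(2)[OF assms(3) \<gamma> assms(9)[OF that] d1[OF that]])
  have mass: "divergence (\<lambda>y. \<rho> y *\<^sub>R U y) y = 0" and crocco: "grad B y = U y \<times> curl U y"
    if "y \<in> \<Omega>" for y
    unfolding B_def U_def
    by (rule steady_euler_mass_and_crocco[OF assms(3) \<gamma> assms(9)[OF that] d1[OF that] assms(11) that])+
  have UU: "U y \<bullet> U y = (u1 y)\<^sup>2 + (u2 y)\<^sup>2 + (u3 y)\<^sup>2" for y
    by (simp add: U_def inner_vec_def sum_3 power2_eq_square)
  have UU_B: "U y \<bullet> U y = 2 * (B y - h (\<rho> y))" for y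
    by (simp add: UU B_def bernoulli_def)
  have \<rho>nz: "\<rho> y \<noteq> 0" if "y \<in> \<Omega>" for y
    using assms(9)[OF that] by simp
  have Unz: "U y \<noteq> 0" if "y \<in> \<Omega>" for y
    using assms(10)[OF that] by (auto simp: U_def vec_eq_iff forall_3)
  have G: "G y = (U y \<bullet> U y) / (u1 y)\<^sup>2" if "y \<in> \<Omega>" for y
    using assms(10)[OF that]
    by (simp add: G_def UU \<beta>2_def \<beta>3_def power_divide field_simps)
  have W: "W y = (U y \<bullet> curl U y) / (u1 y)\<^sup>2" if "y \<in> \<Omega>" for y
    using W_flow_eq_helicity[OF d1(2-4)[OF that]] assms(10)[OF that]
    unfolding W_def \<beta>2_def \<beta>3_def U_def by simp
  have "D_flow \<beta>2 \<beta>3 W x - W x * D_flow \<beta>2 \<beta>3 (\<lambda>x. ln (\<rho> x)) x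
        - inverse (G x) * W x * D_flow \<beta>2 \<beta>3 G x
         - (sound_speed \<gamma> (\<rho> x))\<^sup>2 * G x / (2 * (B x - h (\<rho> x))\<^sup>2) *
           ((\<partial> 2 B x * \<partial> 3 (\<lambda>x. ln (\<rho> x)) x - \<partial> 3 B x * \<partial> 2 (\<lambda>x. ln (\<rho> x)) x)
            + \<beta>2 x * (\<partial> 3 B x * \<partial> 1 (\<lambda>x. ln (\<rho> x)) x - \<partial> 1 B x * \<partial> 3 (\<lambda>x. ln (\<rho> x)) x)
            + \<beta>3 x * (\<partial> 1 B x * \<partial> 2 (\<lambda>x. ln (\<rho> x)) x - \<partial> 2 B x * \<partial> 1 (\<lambda>x. ln (\<rho> x)) x)) = 0"
      (is ?first)
    and "D_flow \<beta>2 \<beta>3 (\<lambda>y. W y / (\<rho> y * G y)) x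
         + (sound_speed \<gamma> (\<rho> x))\<^sup>2 / (2 * (\<rho> x)\<^sup>2 * (B x - h (\<rho> x))\<^sup>2) *
           (vector [1, \<beta>2 x, \<beta>3 x] \<bullet> (grad \<rho> x \<times> grad B x)) = 0" (is ?second)
    if x: "x \<in> \<Omega>" for x
  proof -
    define C where "C = (sound_speed \<gamma> (\<rho> x))\<^sup>2"
    define T where "T = vector [1, \<beta>2 x, \<beta>3 x] \<bullet> (grad \<rho> x \<times> grad B x)"
    define K where "K = B x - h (\<rho> x)"
    note pos = assms(9)[OF x] assms(10)[OF x]
    have K: "K > 0" "U x \<bullet> U x = 2 * K"
      using Unz[OF x] UU_B[of x] inner_gt_zero_iff[of "U x"] by (auto simp: K_def)
    have Ux: "U x = u1 x *\<^sub>R vector [1, \<beta>2 x, \<beta>3 x]"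
      using pos(2) by (simp add: U_def \<beta>2_def \<beta>3_def vec_eq_iff forall_3)
    have nx: "n x = inverse (2 * K)"
      by (simp add: n_def K)
    \<comment> \<open>Here \<open>n = 1 / (2 (B - h))\<close> and \<open>\<nabla>h = (c\<^sup>2 / \<rho>) \<nabla>\<rho>\<close>. The \<open>\<nabla>B\<close> part is orthogonal to
      \<open>U \<times> \<nabla>B\<close>, which leaves the density gradient as the only source.\<close>
    have n: "grad n x = - (2 * (n x)\<^sup>2) *\<^sub>R (grad B x - (C / \<rho> x) *\<^sub>R grad \<rho> x)"
    proof -
      note hx = partial_deriv_compose[OF d1(1)[OF x] is_enthalpy_has_derivative[OF assms(3) \<gamma> pos(1)]]
      have BK: "(\<lambda>y. B y - h (\<rho> y)) differentiable (at x)"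
        using B[OF x] hx(2) by (rule differentiable_diff)
      have inv: "((\<lambda>k. inverse (2 * k)) has_real_derivative - (2 * (n x)\<^sup>2)) (at (B x - h (\<rho> x)))"
        unfolding nx K_def[symmetric] using K(1)
        by (auto intro!: derivative_eq_intros simp: power2_eq_square field_simps)
      have "\<partial> i n x = - (2 * (n x)\<^sup>2) * (\<partial> i B x - C / \<rho> x * \<partial> i \<rho> x)" for i
        using partial_deriv_compose(1)[OF BK inv, of i]
        by (simp add: n_def UU_B C_def partial_deriv_diff B[OF x] hx)
      then show ?thesis
        by (simp add: vec_eq_iff grad_def)
    qed
    \<comment> \<open>\<open>W\<close> and \<open>G\<close> both carry the factor \<open>1 / u\<^sub>1\<^sup>2\<close>, so the transported quantity is the helicity
      density divided by \<open>\<rho> |U|\<^sup>2\<close>.\<close>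
    have "\<partial> i (\<lambda>y. W y / (\<rho> y * G y)) x = \<partial> i (\<lambda>y. (U y \<bullet> curl U y) / (\<rho> y * (U y \<bullet> U y))) x" for i
    proof (rule partial_deriv_cong_open[OF assms(4) x])
      fix y assume "y \<in> \<Omega>"
      then show "W y / (\<rho> y * G y) = (U y \<bullet> curl U y) / (\<rho> y * (U y \<bullet> U y))"
        using assms(10)[of y] by (simp add: W G)
    qed
    then have D_eq: "u1 x * D_flow \<beta>2 \<beta>3 (\<lambda>y. W y / (\<rho> y * G y)) x
        = U x \<bullet> grad (\<lambda>y. (U y \<bullet> curl U y) / (\<rho> y * (U y \<bullet> U y))) x"
      by (simp add: D_flow_def grad_def Ux inner_vec_def sum_3 algebra_simps)
    have "\<rho> x * (U x \<bullet> grad (\<lambda>y. (U y \<bullet> curl U y) / (\<rho> y * (U y \<bullet> U y))) x)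
        = grad n x \<bullet> (U x \<times> grad B x)"
      unfolding n_def
      by (rule helicity_transport[OF assms(4) x U U2[OF x] B d1(1)[OF x] \<rho>nz Unz mass[OF x] crocco])
    also have "\<dots> = 2 * (n x)\<^sup>2 * (C / \<rho> x) * (grad \<rho> x \<bullet> (U x \<times> grad B x))"
      by (simp add: n inner_diff_left dot_cross_self)
    also have "grad \<rho> x \<bullet> (U x \<times> grad B x) = - u1 x * T"
      unfolding Ux T_def by (simp add: cross3_simps)
    also note nx
    finally have "u1 x * D_flow \<beta>2 \<beta>3 (\<lambda>y. W y / (\<rho> y * G y)) x
        = u1 x * - (C / (2 * (\<rho> x)\<^sup>2 * K\<^sup>2) * T)"
      unfolding D_eq[symmetric] using pos K
      by (simp add: field_simps power2_eq_square)
    then have D_m: "D_flow \<beta>2 \<beta>3 (\<lambda>y. W y / (\<rho> y * G y)) x = - (C / (2 * (\<rho> x)\<^sup>2 * K\<^sup>2) * T)"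
      using pos(2) by (subst (asm) mult_left_cancel) auto
    then show ?second
      by (simp add: C_def K_def T_def)
    have Gx: "G x \<noteq> 0"
      using pos K by (simp add: G[OF x])
    have "G differentiable (at x)"
      using d1[OF x] pos unfolding G_def \<beta>2_def \<beta>3_def by simp
    moreover have "W differentiable (at x)"
    proof (rule differentiable_cong_open[OF _ assms(4) x W[symmetric]])
      show "(\<lambda>y. (U y \<bullet> curl U y) / (u1 y)\<^sup>2) differentiable (at x)"
        using d1[OF x] pos U[OF x] differentiable_curl[OF U2[OF x]] by simp
    qed
    ultimately have quotient: "\<rho> x * G x * D_flow \<beta>2 \<beta>3 (\<lambda>y. W y / (\<rho> y * G y)) x
      = D_flow \<beta>2 \<beta>3 W x - W x * D_flow \<beta>2 \<beta>3 (\<lambda>y. ln (\<rho> y)) x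
        - inverse (G x) * W x * D_flow \<beta>2 \<beta>3 G x"
      using Gx pos d1[OF x] by (intro D_flow_quotient) auto
    have source: "(\<partial> 2 B x * \<partial> 3 (\<lambda>x. ln (\<rho> x)) x - \<partial> 3 B x * \<partial> 2 (\<lambda>x. ln (\<rho> x)) x)
            + \<beta>2 x * (\<partial> 3 B x * \<partial> 1 (\<lambda>x. ln (\<rho> x)) x - \<partial> 1 B x * \<partial> 3 (\<lambda>x. ln (\<rho> x)) x)
            + \<beta>3 x * (\<partial> 1 B x * \<partial> 2 (\<lambda>x. ln (\<rho> x)) x - \<partial> 2 B x * \<partial> 1 (\<lambda>x. ln (\<rho> x)) x)
        = - T / \<rho> x"
      using pos(1) unfolding partial_deriv_ln[OF d1(1)[OF x] pos(1)]
      by (simp add: T_def inner_vec_def sum_3 cross_components grad_def field_simps)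
    show ?first
      unfolding quotient[symmetric] source D_m C_def[symmetric] K_def[symmetric]
      using pos K(1) by (simp add: field_simps power2_eq_square)
  qed
  then show ?thesis
    unfolding Let_def \<beta>2_def \<beta>3_def G_def B_def W_def by blast
qed

end
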